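(* Let $k\ge1$ and let $n$ be the least natural number such that $\binom{n}{\lfloor n/2\rfloor}\ge k$. Then ${\sf IPC}+\varphi_k$ is complete with respect to the class of finite Kripke frames of topwidth at most $n$ (a formula is derivable in ${\sf IPC}+\varphi_k$ iff it holds in every finite Kripke frame of topwidth at most $n$). Moreover, ${\sf IPC}+\varphi_k$ is decidable. Here $\varphi_1=\neg p\vee\neg\neg p$ and, for $k>1$, $\varphi_k=\bigvee_{1\le i,j\le k,\ i\neq j}(\neg p_i\rightarrow\neg p_j)\vee\neg(\neg p_1\wedge\cdots\wedge\neg p_k)$.
   Context: ${\sf IPC}$ is the intuitionistic propositional calculus; ${\sf IPC}+\varphi$ denotes the deductive closure of ${\sf IPC}$ together with all substitution instances of $\varphi$. Kripke frames are partial orders $\langle K,R\rangle$ with a root (least element); valuations are upward closed; forcing is the usual intuitionistic Kripke forcing; a formula holds in a frame if it is forced at every node under every valuation. A Kripke frame has topwidth $k$ if it has exactly $k$ maximal nodes $x_1,\dots,x_k$ and every node $y$ satisfies $yRx_i$ for some $i$.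
   Formalization: The least n is taken among positive natural numbers: for k=1 allowing n=0 would leave no frames and make the claim false, so n=1 there (nothing changes for k>1). Finite Kripke frames are taken with natural numbers as nodes, which is no restriction up to isomorphism. *)

theory Defs
  imports Complex_Main "HOL-Library.Nat_Bijection"
begin

subsection \<open>Formulas and the intuitionistic propositional calculus\<close>

datatype fm =
    Bot
  | Var nat
  | And fm fm
  | Or fm fm
  | Imp fm fm

abbreviation Neg :: "fm \<Rightarrow> fm" where
  "Neg a \<equiv> Imp a Bot"

primrec subst :: "(nat \<Rightarrow> fm) \<Rightarrow> fm \<Rightarrow> fm" where
  "subst \<sigma> Bot = Bot"
| "subst \<sigma> (Var p) = \<sigma> p"
| "subst \<sigma> (And a b) = And (subst \<sigma> a) (subst \<sigma> b)"
| "subst \<sigma> (Or a b) = Or (subst \<sigma> a) (subst \<sigma> b)"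
| "subst \<sigma> (Imp a b) = Imp (subst \<sigma> a) (subst \<sigma> b)"

text \<open>Hilbert-style calculus; \<open>A\<close> is a set of additional axioms, to which no substitution is
  applied.\<close>

inductive ipc_derivable :: "fm set \<Rightarrow> fm \<Rightarrow> bool" for A :: "fm set" where
  assm: "a \<in> A \<Longrightarrow> ipc_derivable A a"
| imp_K: "ipc_derivable A (Imp a (Imp b a))"
| imp_S: "ipc_derivable A (Imp (Imp a (Imp b c)) (Imp (Imp a b) (Imp a c)))"
| and_E1: "ipc_derivable A (Imp (And a b) a)"
| and_E2: "ipc_derivable A (Imp (And a b) b)"
| and_I: "ipc_derivable A (Imp a (Imp b (And a b)))"
| or_I1: "ipc_derivable A (Imp a (Or a b))"
| or_I2: "ipc_derivable A (Imp b (Or a b))"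
| or_E: "ipc_derivable A (Imp (Imp a c) (Imp (Imp b c) (Imp (Or a b) c)))"
| bot_E: "ipc_derivable A (Imp Bot a)"
| MP: "ipc_derivable A (Imp a b) \<Longrightarrow> ipc_derivable A a \<Longrightarrow> ipc_derivable A b"

definition IPC_plus :: "fm \<Rightarrow> fm set" where
  "IPC_plus a = {b. ipc_derivable {subst \<sigma> a | \<sigma>. True} b}"


subsection \<open>The formulas \<open>\<phi>\<^sub>k\<close>\<close>

fun Disj :: "fm list \<Rightarrow> fm" where
  "Disj [] = Bot"
| "Disj [a] = a"
| "Disj (a # b # as) = Or a (Disj (b # as))"

fun Conj :: "fm list \<Rightarrow> fm" where
  "Conj [] = Neg Bot"
| "Conj [a] = a"
| "Conj (a # b # as) = And a (Conj (b # as))"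

text \<open>Only used for \<open>k \<ge> 1\<close>.\<close>

definition phi :: "nat \<Rightarrow> fm" where
  "phi k = (if k = 1 then Or (Neg (Var 1)) (Neg (Neg (Var 1)))
     else Or
       (Disj [Imp (Neg (Var i)) (Neg (Var j)). i \<leftarrow> [1..<Suc k], j \<leftarrow> [1..<Suc k], i \<noteq> j])
       (Neg (Conj [Neg (Var i). i \<leftarrow> [1..<Suc k]])))"


subsection \<open>Kripke semantics\<close>

definition kripke_frame :: "'w set \<Rightarrow> 'w rel \<Rightarrow> bool" where
  "kripke_frame K R \<longleftrightarrow> partial_order_on K R \<and> (\<exists>r\<in>K. \<forall>x\<in>K. (r, x) \<in> R)"

definition valuation :: "'w set \<Rightarrow> 'w rel \<Rightarrow> (nat \<Rightarrow> 'w set) \<Rightarrow> bool" where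
  "valuation K R V \<longleftrightarrow> (\<forall>p. V p \<subseteq> K \<and> (\<forall>x y. x \<in> V p \<longrightarrow> (x, y) \<in> R \<longrightarrow> y \<in> V p))"

primrec forces :: "'w set \<Rightarrow> 'w rel \<Rightarrow> (nat \<Rightarrow> 'w set) \<Rightarrow> 'w \<Rightarrow> fm \<Rightarrow> bool" where
  "forces K R V x Bot \<longleftrightarrow> False"
| "forces K R V x (Var p) \<longleftrightarrow> x \<in> V p"
| "forces K R V x (And a b) \<longleftrightarrow> forces K R V x a \<and> forces K R V x b"
| "forces K R V x (Or a b) \<longleftrightarrow> forces K R V x a \<or> forces K R V x b"
| "forces K R V x (Imp a b) \<longleftrightarrow>
     (\<forall>y\<in>K. (x, y) \<in> R \<longrightarrow> forces K R V y a \<longrightarrow> forces K R V y b)"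

definition holds_in :: "'w set \<Rightarrow> 'w rel \<Rightarrow> fm \<Rightarrow> bool" where
  "holds_in K R a \<longleftrightarrow> (\<forall>V. valuation K R V \<longrightarrow> (\<forall>x\<in>K. forces K R V x a))"

definition maximal_nodes :: "'w set \<Rightarrow> 'w rel \<Rightarrow> 'w set" where
  "maximal_nodes K R = {x \<in> K. \<forall>y\<in>K. (x, y) \<in> R \<longrightarrow> y = x}"

definition has_topwidth :: "'w set \<Rightarrow> 'w rel \<Rightarrow> nat \<Rightarrow> bool" where
  "has_topwidth K R m \<longleftrightarrow>
     finite (maximal_nodes K R) \<and> card (maximal_nodes K R) = m \<and>
     (\<forall>y\<in>K. \<exists>x\<in>maximal_nodes K R. (y, x) \<in> R)"

definition topwidth_at_most :: "'w set \<Rightarrow> 'w rel \<Rightarrow> nat \<Rightarrow> bool" where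
  "topwidth_at_most K R n \<longleftrightarrow> (\<exists>m\<le>n. has_topwidth K R m)"

text \<open>A quantifier over all frames has to fix the type of the nodes. For finite frames \<open>nat\<close> is
  general enough, by the following transfer along bijections.\<close>

lemma map_prod_image_iff:
  assumes "inj_on h K" "R \<subseteq> K \<times> K" "x \<in> K" "y \<in> K"
  shows "(h x, h y) \<in> map_prod h h ` R \<longleftrightarrow> (x, y) \<in> R"
proof
  assume "(h x, h y) \<in> map_prod h h ` R"
  then obtain x' y' where *: "(x', y') \<in> R" "h x = h x'" "h y = h y'" by auto
  with assms have "x = x'" "y = y'" by (auto dest: inj_onD)
  with * show "(x, y) \<in> R" by simp
next
  assume "(x, y) \<in> R"
  then show "(h x, h y) \<in> map_prod h h ` R" by (auto intro: rev_image_eqI)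
qed

lemma forces_bij:
  assumes h: "bij_betw h K L" and R: "R \<subseteq> K \<times> K" and V: "\<And>p. V p \<subseteq> K" and "x \<in> K"
  shows "forces L (map_prod h h ` R) (\<lambda>p. h ` V p) (h x) a \<longleftrightarrow> forces K R V x a"
  using \<open>x \<in> K\<close>
proof (induction a arbitrary: x)
  case (Var p)
  have "inj_on h K" using h by (rule bij_betw_imp_inj_on)
  then show ?case using Var V[of p] by (auto dest: inj_onD)
next
  case (Imp a b)
  have inj: "inj_on h K" and L: "L = h ` K" using h by (auto simp: bij_betw_def)
  have "(h x, h y) \<in> map_prod h h ` R \<longleftrightarrow> (x, y) \<in> R" if "y \<in> K" for y
    using map_prod_image_iff[OF inj R Imp.prems that] .
  then show ?case using Imp L by auto
qed auto

lemma finite_frames_nat: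
  fixes K :: "'w set" and R :: "'w rel"
  assumes nat: "\<forall>(L :: nat set) S. kripke_frame L S \<and> finite L \<and> topwidth_at_most L S n
      \<longrightarrow> holds_in L S a"
    and fr: "kripke_frame K R" and fin: "finite K" and tw: "topwidth_at_most K R n"
  shows "holds_in K R a"
proof -
  obtain h :: "'w \<Rightarrow> nat" and m where "h ` K = {i. i < m}" and inj: "inj_on h K"
    using finite_imp_inj_to_nat_seg[OF fin] by blast
  define L where "L = h ` K"
  define S where "S = map_prod h h ` R"
  have bij: "bij_betw h K L" using inj by (simp add: bij_betw_def L_def)
  have R: "R \<subseteq> K \<times> K" and refl: "refl_on K R" and tr: "trans R" and anti: "antisym R"
    using fr by (auto simp: kripke_frame_def partial_order_on_def preorder_on_def)
  have S: "(h x, h y) \<in> S \<longleftrightarrow> (x, y) \<in> R" if "x \<in> K" "y \<in> K" for x y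
    using map_prod_image_iff[OF inj R that] by (simp add: S_def)
  have SE: "\<exists>x\<in>K. \<exists>y\<in>K. u = h x \<and> v = h y \<and> (x, y) \<in> R" if "(u, v) \<in> S" for u v
    using that R by (force simp: S_def)
  have "S \<subseteq> L \<times> L" using R by (auto simp: S_def L_def)
  moreover have "refl_on L S" using refl S by (auto simp: refl_on_def L_def)
  moreover have "trans S"
  proof (rule transI)
    fix u v w assume "(u, v) \<in> S" "(v, w) \<in> S"
    then obtain x y y' z where "x \<in> K" "y \<in> K" "y' \<in> K" "z \<in> K" "u = h x" "v = h y" "v = h y'"
      "w = h z" "(x, y) \<in> R" "(y', z) \<in> R" using SE by meson
    then show "(u, w) \<in> S" using inj tr S by (metis inj_onD transD)
  qed
  moreover have "antisym S"
  proof (rule antisymI)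
    fix u v assume a: "(u, v) \<in> S" "(v, u) \<in> S"
    then obtain x y where "x \<in> K" "y \<in> K" "u = h x" "v = h y" using SE by meson
    then show "u = v" using a S anti by (metis antisymD)
  qed
  moreover have "\<exists>r\<in>L. \<forall>x\<in>L. (r, x) \<in> S"
    using fr S by (fastforce simp: kripke_frame_def L_def)
  ultimately have frL: "kripke_frame L S"
    by (simp add: kripke_frame_def partial_order_on_def preorder_on_def)
  have mx: "maximal_nodes L S = h ` maximal_nodes K R"
  proof -
    have "h x \<in> maximal_nodes L S \<longleftrightarrow> x \<in> maximal_nodes K R" if x: "x \<in> K" for x
    proof -
      have "h y = h x \<longleftrightarrow> y = x" if "y \<in> K" for y using inj that x by (rule inj_on_eq_iff)
      then show ?thesis using x S[OF x] unfolding maximal_nodes_def L_def by auto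
    qed
    moreover have "maximal_nodes L S \<subseteq> h ` K" "maximal_nodes K R \<subseteq> K"
      by (auto simp: maximal_nodes_def L_def)
    ultimately show ?thesis by blast
  qed
  have sub: "maximal_nodes K R \<subseteq> K" by (auto simp: maximal_nodes_def)
  have card: "card (maximal_nodes L S) = card (maximal_nodes K R)"
    unfolding mx by (rule card_image) (rule inj_on_subset[OF inj sub])
  obtain m where m: "m \<le> n" and twm: "has_topwidth K R m"
    using tw unfolding topwidth_at_most_def by blast
  have "\<exists>x\<in>maximal_nodes L S. (y, x) \<in> S" if yL: "y \<in> L" for y
  proof -
    obtain z where z: "z \<in> K" "y = h z" using yL unfolding L_def by blast
    then obtain x where x: "x \<in> maximal_nodes K R" "(z, x) \<in> R"
      using twm unfolding has_topwidth_def by blast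
    then have "(y, h x) \<in> S" using S[of z x] z sub by blast
    then show ?thesis unfolding mx using x by blast
  qed
  moreover have "finite (maximal_nodes L S)" "card (maximal_nodes L S) = m"
    using twm card unfolding mx has_topwidth_def by simp_all
  ultimately have "has_topwidth L S m" unfolding has_topwidth_def by blast
  then have "topwidth_at_most L S n" using m unfolding topwidth_at_most_def by blast
  moreover have "finite L" using fin by (simp add: L_def)
  ultimately have hL: "holds_in L S a" using nat frL by blast
  show ?thesis unfolding holds_in_def
  proof (intro allI impI ballI)
    fix V x assume V: "valuation K R V" and x: "x \<in> K"
    have VK: "V p \<subseteq> K" for p using V by (simp add: valuation_def)
    have "valuation L S (\<lambda>p. h ` V p)"
      unfolding valuation_def
    proof (intro allI conjI impI)
      fix p show "h ` V p \<subseteq> L" using VK by (auto simp: L_def)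
      fix u v assume u: "u \<in> h ` V p" and uv: "(u, v) \<in> S"
      obtain y z where "y \<in> K" "z \<in> K" "u = h y" "v = h z" "(y, z) \<in> R" using SE[OF uv] by blast
      moreover have "y \<in> V p" using u \<open>u = h y\<close> \<open>y \<in> K\<close> VK[of p] inj by (auto dest: inj_onD)
      ultimately show "v \<in> h ` V p" using V by (auto simp: valuation_def)
    qed
    then have "forces L S (\<lambda>p. h ` V p) (h x) a" using hL x by (simp add: holds_in_def L_def)
    then show "forces K R V x a" using forces_bij[OF bij R VK x] by (simp add: S_def)
  qed
qed


subsection \<open>Decidability\<close>

text \<open>\<open>recursive_fun n f\<close>: \<open>f\<close>, restricted to argument lists of length \<open>n\<close>, is a total (general)
  recursive function of \<open>n\<close> arguments. Unbounded search is only allowed where it always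
  terminates.\<close>

inductive recursive_fun :: "nat \<Rightarrow> (nat list \<Rightarrow> nat) \<Rightarrow> bool" where
  zero: "recursive_fun n (\<lambda>xs. 0)"
| succ: "recursive_fun 1 (\<lambda>xs. Suc (xs ! 0))"
| proj: "i < n \<Longrightarrow> recursive_fun n (\<lambda>xs. xs ! i)"
| comp: "recursive_fun (length gs) f \<Longrightarrow> (\<forall>g\<in>set gs. recursive_fun n g) \<Longrightarrow>
    recursive_fun n (\<lambda>xs. f (map (\<lambda>g. g xs) gs))"
| prim_rec: "recursive_fun n f \<Longrightarrow> recursive_fun (Suc (Suc n)) g \<Longrightarrow>
    recursive_fun (Suc n)
      (\<lambda>xs. rec_nat (f (tl xs)) (\<lambda>m r. g (m # r # tl xs)) (hd xs))"
| mu: "recursive_fun (Suc n) f \<Longrightarrow> (\<And>xs. length xs = n \<Longrightarrow> \<exists>m. f (m # xs) = 0) \<Longrightarrow>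
    recursive_fun n (\<lambda>xs. LEAST m. f (m # xs) = 0)"

definition recursive_set :: "nat set \<Rightarrow> bool" where
  "recursive_set A \<longleftrightarrow> (\<exists>f. recursive_fun 1 f \<and> (\<forall>x. f [x] = (if x \<in> A then 1 else 0)))"

text \<open>A bijective Goedel numbering.\<close>

primrec fm_code :: "fm \<Rightarrow> nat" where
  "fm_code Bot = 0"
| "fm_code (Var p) = Suc (4 * p)"
| "fm_code (And a b) = Suc (4 * prod_encode (fm_code a, fm_code b) + 1)"
| "fm_code (Or a b) = Suc (4 * prod_encode (fm_code a, fm_code b) + 2)"
| "fm_code (Imp a b) = Suc (4 * prod_encode (fm_code a, fm_code b) + 3)"

lemma bij_fm_code: "bij fm_code"
proof (rule bijI)
  have "fm_code a = fm_code b \<Longrightarrow> a = b" for a b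
  proof (induction a arbitrary: b)
    case Bot then show ?case by (cases b) auto
  next
    case (Var p) then show ?case by (cases b; simp; presburger)
  next
    case (And a1 a2)
    from And.prems have "\<exists>b1 b2. b = And b1 b2 \<and>
        prod_encode (fm_code a1, fm_code a2) = prod_encode (fm_code b1, fm_code b2)"
      by (cases b; simp; presburger)
    then show ?case using And.IH by auto
  next
    case (Or a1 a2)
    from Or.prems have "\<exists>b1 b2. b = Or b1 b2 \<and>
        prod_encode (fm_code a1, fm_code a2) = prod_encode (fm_code b1, fm_code b2)"
      by (cases b; simp; presburger)
    then show ?case using Or.IH by auto
  next
    case (Imp a1 a2)
    from Imp.prems have "\<exists>b1 b2. b = Imp b1 b2 \<and>
        prod_encode (fm_code a1, fm_code a2) = prod_encode (fm_code b1, fm_code b2)"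
      by (cases b; simp; presburger)
    then show ?case using Imp.IH by auto
  qed
  then show "inj fm_code" by (rule injI)
  have "\<exists>a. fm_code a = c" for c
  proof (induction c rule: less_induct)
    case (less c)
    show ?case
    proof (cases c)
      case 0 then show ?thesis by (metis fm_code.simps(1))
    next
      case (Suc d)
      define q where "q = d div 4"
      obtain x y where q: "prod_encode (x, y) = q" by (metis prod_decode_inverse surj_pair)
      have "x \<le> q" "y \<le> q" using q le_prod_encode_1 le_prod_encode_2 by blast+
      then have "x < c" "y < c" using Suc by (auto simp: q_def)
      then obtain a b where ab: "fm_code a = x" "fm_code b = y" using less by blast
      have "d = 4 * q \<or> d = 4 * q + 1 \<or> d = 4 * q + 2 \<or> d = 4 * q + 3"
        unfolding q_def by presburger
      then have "c = fm_code (Var q) \<or> c = fm_code (And a b) \<or> c = fm_code (Or a b)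
          \<or> c = fm_code (Imp a b)"
        unfolding fm_code.simps ab q Suc by presburger
      then show ?thesis by metis
    qed
  qed
  then show "surj fm_code" by (metis surjI)
qed

definition decidable :: "fm set \<Rightarrow> bool" where
  "decidable A \<longleftrightarrow> recursive_set (fm_code ` A)"

end

theory Submission
  imports Defs
begin

text \<open>
  At a node \<open>x\<close>, let \<open>A\<^sub>i\<close> be the set of maximal nodes above \<open>x\<close> that force \<open>\<not>p\<^sub>i\<close>. For \<open>k > 1\<close> the formula
  \<open>\<phi>\<^sub>k\<close> fails at \<open>x\<close> iff the \<open>A\<^sub>i\<close> form an antichain of \<open>k\<close> sets with a common element; removing that element,
  Sperner's theorem gives soundness for topwidth at most \<open>n\<close>. Conversely, if a prime theory
  containing all instances of \<open>\<phi>\<^sub>k\<close> had \<open>n + 1\<close> complete extensions, then the subsets of size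
  \<open>\<lfloor>n/2\<rfloor>\<close> of \<open>n\<close> of them, each enlarged by the remaining one, would refute an instance, since
  finitely many complete theories can be separated by formulas. Hence the canonical model, cut down
  to the formulas with code at most \<open>c\<close>, is a finite model of topwidth at most \<open>n\<close>. It is a set of
  subsets of \<open>{0..c}\<close>, so a countermodel can be found by a bounded search, which is primitive recursive.
\<close>

section \<open>Antichains of subsets\<close>

text \<open>Averaging over the deletion of one point: for each x in S the members of F that omit x
  form an antichain in \<open>S - {x}\<close>, and the sum for S is the mean of the sums for these
  smaller sets. Only \<open>S \<in> F\<close> escapes the averaging, and then F is
  \<open>{S}\<close>.\<close>

lemma lym_inequality:
  assumes "finite S" "F \<subseteq> Pow S" and anti: "\<And>A B. A \<in> F \<Longrightarrow> B \<in> F \<Longrightarrow> A \<subseteq> B \<Longrightarrow> A = B"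
  shows "(\<Sum>A\<in>F. 1 / real (card S choose card A)) \<le> 1"
  using assms
proof (induction "card S" arbitrary: S F)
  case 0
  then have "F \<subseteq> {{}}" by auto
  then consider "F = {}" | "F = {{}}" by blast
  then show ?case by cases auto
next
  case (Suc n)
  have finF: "finite F" using Suc.prems(1,2) by (meson finite_Pow_iff finite_subset)
  show ?case
  proof (cases "S \<in> F")
    case True
    have "A = S" if "A \<in> F" for A using Suc.prems(2) Suc.prems(3)[OF that True] that by blast
    then have "F = {S}" using True by blast
    then show ?thesis by simp
  next
    case False
    \<comment> \<open>A proper subset of size \<open>a\<close> is counted once for each of the \<open>n + 1 - a\<close> points it omits.\<close>
    have w: "1 / real (card S choose card A)
        = (\<Sum>x\<in>S. if x \<notin> A then 1 / real (n choose card A) else 0) / real (Suc n)"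
      if "A \<in> F" for A
    proof -
      have A: "A \<subseteq> S" "A \<noteq> S" using that Suc.prems(2) False by auto
      then have lt: "card A \<le> n" using psubset_card_mono[of S A] Suc.prems(1) Suc.hyps(2) by (simp add: psubset_eq)
      have S: "{x \<in> S. x \<notin> A} = S - A" by auto
      have "card (S - A) = Suc n - card A"
        using A Suc.prems(1) Suc.hyps(2) by (simp add: card_Diff_subset finite_subset)
      then have "(\<Sum>x\<in>S. if x \<notin> A then 1 / real (n choose card A) else 0)
          = real (Suc n - card A) * (1 / real (n choose card A))"
        unfolding sum.inter_filter[OF Suc.prems(1), symmetric] S by simp
      moreover have "1 / real (Suc n choose card A)
          = real (Suc n - card A) * (1 / real (n choose card A)) / real (Suc n)"
      proof -
        have "(Suc n - card A) * (Suc n choose card A) = Suc n * (n choose card A)"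
          using binomial_absorb_comp[of "Suc n" "card A"] by simp
        then have "real (Suc n - card A) * real (Suc n choose card A) = real (Suc n) * real (n choose card A)"
          by (metis of_nat_mult)
        moreover have "real (n choose card A) > 0" "real (Suc n choose card A) > 0" "real (Suc n) > 0"
          using lt by auto
        ultimately show ?thesis by (simp add: divide_simps del: of_nat_Suc binomial_Suc_Suc of_nat_diff)
      qed
      ultimately show ?thesis unfolding Suc.hyps(2)[symmetric] by simp
    qed
    have "(\<Sum>A\<in>F. 1 / real (card S choose card A))
        = (\<Sum>A\<in>F. \<Sum>x\<in>S. if x \<notin> A then 1 / real (n choose card A) else 0) / real (Suc n)"
      unfolding sum_divide_distrib[of _ F] by (rule sum.cong[OF refl w])
    also have "(\<Sum>A\<in>F. \<Sum>x\<in>S. if x \<notin> A then 1 / real (n choose card A) else 0)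
        = (\<Sum>x\<in>S. \<Sum>A\<in>{A\<in>F. x \<notin> A}. 1 / real (n choose card A))"
      by (subst sum.swap) (simp add: sum.inter_filter[OF finF])
    \<comment> \<open>After the exchange of sums, each inner sum is the LYM sum of an antichain in
      \<open>S - {x}\<close>, so the induction hypothesis bounds it by 1.\<close>
    also have "\<dots> \<le> (\<Sum>x\<in>S. 1)"
    proof (rule sum_mono)
      fix x assume x: "x \<in> S"
      have n: "n = card (S - {x})" using x Suc.prems(1) Suc.hyps(2) by simp
      show "(\<Sum>A\<in>{A\<in>F. x \<notin> A}. 1 / real (n choose card A)) \<le> 1"
        unfolding n by (rule Suc.hyps(1)[OF n]) (use Suc.prems in auto)
    qed
    finally show ?thesis using Suc.hyps(2) by (simp add: divide_le_eq del: of_nat_Suc)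
  qed
qed

text \<open>The LYM inequality with every binomial coefficient replaced by the middle one, which is
  the largest.\<close>

theorem sperner:
  assumes "finite S" "F \<subseteq> Pow S" and "\<And>A B. A \<in> F \<Longrightarrow> B \<in> F \<Longrightarrow> A \<subseteq> B \<Longrightarrow> A = B"
  shows "card F \<le> card S choose (card S div 2)"
proof -
  have "real (card F) / real (card S choose (card S div 2))
      = (\<Sum>A\<in>F. 1 / real (card S choose (card S div 2)))" by simp
  also have "\<dots> \<le> (\<Sum>A\<in>F. 1 / real (card S choose card A))"
  proof (rule sum_mono)
    fix A assume "A \<in> F"
    then have "card A \<le> card S" using assms(1,2) by (auto intro: card_mono)
    then show "1 / real (card S choose (card S div 2)) \<le> 1 / real (card S choose card A)"
      using binomial_maximum[of "card S" "card A"] by (intro divide_left_mono) auto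
  qed
  also have "\<dots> \<le> 1" using assms by (rule lym_inequality)
  finally show ?thesis by (simp add: divide_le_eq split: if_splits)
qed

section \<open>Soundness\<close>

lemma forces_mono:
  assumes "partial_order_on K R" "valuation K R V" "forces K R V x a" "(x, y) \<in> R"
  shows "forces K R V y a"
  using assms(3)
proof (induction a)
  case (Var p)
  then show ?case using assms by (auto simp: valuation_def)
next
  case (Imp a b)
  have "(x, z) \<in> R" if "(y, z) \<in> R" for z
    using assms(1,4) that by (auto simp: partial_order_on_def preorder_on_def dest: transD)
  then show ?case using Imp.prems by auto
qed auto

lemma ipc_sound:
  assumes po: "partial_order_on K R" and "ipc_derivable A b" and "\<And>a. a \<in> A \<Longrightarrow> holds_in K R a"
  shows "holds_in K R b"
  using assms(2)
proof (induction rule: ipc_derivable.induct)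
  case (MP a b)
  have "(x, x) \<in> R" if "x \<in> K" for x
    using po that by (auto simp: partial_order_on_def preorder_on_def refl_on_def)
  then show ?case using MP.IH by (auto simp: holds_in_def)
next
  case (imp_K a b)
  then show ?case using forces_mono[OF po] by (auto simp: holds_in_def)
next
  case (imp_S a b c)
  have "trans R" "refl_on K R" using po by (auto simp: partial_order_on_def preorder_on_def)
  then show ?case unfolding holds_in_def forces.simps by (meson refl_onD transD)
next
  case (and_I a b)
  then show ?case using forces_mono[OF po] by (auto simp: holds_in_def)
next
  case (or_E a c b)
  have "trans R" "refl_on K R" using po by (auto simp: partial_order_on_def preorder_on_def)
  then show ?case unfolding holds_in_def forces.simps by (meson refl_onD transD)
qed (auto simp: holds_in_def assms(3)[unfolded holds_in_def])

text \<open>A substitution can be absorbed into the valuation, by making each variable true where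
  its substituted formula is forced. This passes validity from \<open>phi k\<close> to its
  instances, the axioms of \<open>IPC_plus (phi k)\<close>.\<close>

lemma holds_in_subst:
  assumes po: "partial_order_on K R" and a: "holds_in K R a"
  shows "holds_in K R (subst \<sigma> a)"
  unfolding holds_in_def
proof (intro allI impI ballI)
  fix V x assume V: "valuation K R V" and x: "x \<in> K"
  define V' where "V' p = {x \<in> K. forces K R V x (\<sigma> p)}" for p
  have "R \<subseteq> K \<times> K" using po by (auto simp: partial_order_on_def preorder_on_def)
  then have "valuation K R V'"
    using forces_mono[OF po V] by (auto simp: valuation_def V'_def)
  moreover have "forces K R V' y b \<longleftrightarrow> forces K R V y (subst \<sigma> b)" if "y \<in> K" for y b
    using that by (induction b arbitrary: y) (auto simp: V'_def)
  ultimately show "forces K R V x (subst \<sigma> a)" using a x unfolding holds_in_def by blast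
qed

lemma forces_Disj: "forces K R V x (Disj as) \<longleftrightarrow> (\<exists>a\<in>set as. forces K R V x a)"
  by (induction as rule: Disj.induct) auto

lemma forces_Conj: "forces K R V x (Conj as) \<longleftrightarrow> (\<forall>a\<in>set as. forces K R V x a)"
  by (induction as rule: Conj.induct) auto

lemma set_phi_disjuncts:
  "set [Imp (Neg (Var i)) (Neg (Var j)). i \<leftarrow> [1..<Suc k], j \<leftarrow> [1..<Suc k], i \<noteq> j]
    = {Imp (Neg (Var i)) (Neg (Var j)) | i j. i \<in> {1..k} \<and> j \<in> {1..k} \<and> i \<noteq> j}"
  by (auto simp del: upt_Suc)

text \<open>The bound concerns \<open>m - 1\<close> because one maximal node common to all sets of
  the antichain is deleted before Sperner's theorem is applied. For k = 1 the formula is weak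
  excluded middle, and a single maximal node decides it.\<close>

lemma phi_holds_in_topwidth:
  assumes po: "partial_order_on K R" and tw: "has_topwidth K R m"
    and k: "k \<ge> 1" and m: "k = 1 \<Longrightarrow> m \<le> 1" "k \<noteq> 1 \<Longrightarrow> (m - 1) choose ((m - 1) div 2) < k"
  shows "holds_in K R (phi k)"
  unfolding holds_in_def
proof (intro allI impI ballI)
  fix V x assume V: "valuation K R V" and x: "x \<in> K"
  have RK: "R \<subseteq> K \<times> K" and tr: "trans R"
    using po by (auto simp: partial_order_on_def preorder_on_def)
  define X where "X = maximal_nodes K R"
  have X: "finite X" "card X = m" and top: "\<And>y. y \<in> K \<Longrightarrow> \<exists>t\<in>X. (y, t) \<in> R"
    using tw by (auto simp: has_topwidth_def X_def)
  have XK: "X \<subseteq> K" and mx: "\<And>t y. t \<in> X \<Longrightarrow> (t, y) \<in> R \<Longrightarrow> y = t"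
    using RK by (auto simp: X_def maximal_nodes_def)
  have up: "z \<in> V p" if "y \<in> V p" "(y, z) \<in> R" for y z p using V that by (auto simp: valuation_def)
  show "forces K R V x (phi k)"
  proof (cases "k = 1")
    case True
    then have "card X \<le> Suc 0" using m(1) X by simp
    then have uniq: "s = t" if "s \<in> X" "t \<in> X" for s t using that X(1) card_le_Suc0_iff_eq by blast
    obtain t where t: "t \<in> X" using top x by blast
    then have tt: "(y, t) \<in> R" if "y \<in> K" for y using top uniq that by metis
    \<comment> \<open>All nodes lie below t. If t misses p_1, no node forces p_1; otherwise every
      node has a successor forcing it.\<close>
    have "y \<notin> V 1" if "t \<notin> V 1" "y \<in> K" for y using up that tt by blast
    then show ?thesis using True t XK tt by (auto simp: phi_def)
  next
    case False
    show ?thesis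
    proof (rule ccontr)
      assume nf: "\<not> ?thesis"
      \<comment> \<open>At a maximal node t, forcing \<open>Neg (Var i)\<close> amounts to
        \<open>t \<notin> V i\<close>.\<close>
      define B where "B i = {t \<in> X. (x, t) \<in> R \<and> t \<notin> V i}" for i
      have notsub: "\<not> B i \<subseteq> B j" if ij: "i \<in> {1..k}" "j \<in> {1..k}" "i \<noteq> j" for i j
      proof -
        have "\<not> forces K R V x (Imp (Neg (Var i)) (Neg (Var j)))"
          using nf ij False unfolding phi_def if_not_P[OF False] forces.simps(4) forces_Disj set_phi_disjuncts by blast
        \<comment> \<open>Here y forces \<open>Neg (Var i)\<close> and z above y forces
          \<open>Var j\<close>; any maximal node above z then separates \<open>B i\<close> from
          \<open>B j\<close>.\<close>
        then obtain y z where yz: "(x, y) \<in> R" "\<forall>u\<in>K. (y, u) \<in> R \<longrightarrow> u \<notin> V i" "(y, z) \<in> R" "z \<in> V j" "z \<in> K"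
          by auto
        then obtain t where t: "t \<in> X" "(z, t) \<in> R" using top by blast
        then have "(y, t) \<in> R" "(x, t) \<in> R" using yz tr by (meson transD)+
        then have "t \<in> B i" "t \<notin> B j" using t yz XK up by (auto simp: B_def)
        then show ?thesis by blast
      qed
      have "\<not> forces K R V x (Neg (Conj [Neg (Var i). i \<leftarrow> [1..<Suc k]]))"
        using nf False by (simp add: phi_def)
      then obtain y where y: "(x, y) \<in> R" "y \<in> K" "\<And>i u. i \<in> {1..k} \<Longrightarrow> u \<in> K \<Longrightarrow> (y, u) \<in> R \<Longrightarrow> u \<notin> V i"
        by (fastforce simp: forces_Conj simp del: upt_Suc)
      then obtain t where t: "t \<in> X" "(y, t) \<in> R" using top by blast
      then have "(x, t) \<in> R" using y tr by (meson transD)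
      then have tB: "t \<in> B i" if "i \<in> {1..k}" for i using that t y XK by (auto simp: B_def)
      \<comment> \<open>As t lies in every \<open>B i\<close>, deleting it creates no new inclusion:
        F is an antichain of k distinct sets.\<close>
      define F where "F = (\<lambda>i. B i - {t}) ` {1..k}"
      have sub: "i = j" if "i \<in> {1..k}" "j \<in> {1..k}" "B i - {t} \<subseteq> B j - {t}" for i j
        using that tB notsub by blast
      have "card F \<le> card (X - {t}) choose (card (X - {t}) div 2)"
      proof (rule sperner)
        show "F \<subseteq> Pow (X - {t})" by (auto simp: F_def B_def)
        show "A = C" if "A \<in> F" "C \<in> F" "A \<subseteq> C" for A C using that sub unfolding F_def by blast
      qed (use X in simp)
      moreover have "inj_on (\<lambda>i. B i - {t}) {1..k}" using sub by (auto intro!: inj_onI)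
      then have "card F = k" by (simp add: F_def card_image)
      moreover have "card (X - {t}) = m - 1" using X t by simp
      ultimately show False using m(2)[OF False] by simp
    qed
  qed
qed

theorem IPC_plus_phi_sound:
  assumes k: "k \<ge> 1" and n: "n = (LEAST m. m \<ge> 1 \<and> m choose (m div 2) \<ge> k)"
    and fr: "kripke_frame K R" and tw: "topwidth_at_most K R n" and a: "a \<in> IPC_plus (phi k)"
  shows "holds_in K R a"
proof -
  have po: "partial_order_on K R" using fr by (simp add: kripke_frame_def)
  obtain m where mn: "m \<le> n" and m: "has_topwidth K R m" using tw by (auto simp: topwidth_at_most_def)
  \<comment> \<open>The root lies below some maximal node. This makes \<open>m - 1\<close> strictly
    smaller than n.\<close>
  have "m \<noteq> 0"
    using fr m unfolding kripke_frame_def has_topwidth_def by (metis card_0_eq empty_iff)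
  have "holds_in K R (phi k)"
  proof (rule phi_holds_in_topwidth[OF po m k])
    assume "k = 1"
    then have "n \<le> 1" unfolding n by (intro Least_le) simp
    then show "m \<le> 1" using mn by simp
  next
    assume "k \<noteq> 1"
    have "m - 1 < n" using mn \<open>m \<noteq> 0\<close> by simp
    then have "\<not> (m - 1 \<ge> 1 \<and> (m - 1) choose ((m - 1) div 2) \<ge> k)" unfolding n by (rule not_less_Least)
    \<comment> \<open>Minimality of n speaks only of numbers at least 1; for
      \<open>m - 1 = 0\<close> the coefficient is 1, which is below k.\<close>
    then show "(m - 1) choose ((m - 1) div 2) < k" using k \<open>k \<noteq> 1\<close> by (cases "m - 1 \<ge> 1") auto
  qed
  then show ?thesis using a holds_in_subst[OF po] ipc_sound[OF po] unfolding IPC_plus_def by blast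
qed

section \<open>Prime and complete theories\<close>

lemma ipc_derivable_mono: "ipc_derivable A a \<Longrightarrow> A \<subseteq> B \<Longrightarrow> ipc_derivable B a"
  by (induction rule: ipc_derivable.induct) (auto intro: ipc_derivable.intros)

lemma ipc_derivable_weaken: "ipc_derivable A b \<Longrightarrow> ipc_derivable A (Imp a b)"
  by (blast intro: imp_K MP)

lemma deduction: "ipc_derivable (insert a A) b \<longleftrightarrow> ipc_derivable A (Imp a b)"
proof
  assume "ipc_derivable (insert a A) b"
  then show "ipc_derivable A (Imp a b)"
  proof (induction rule: ipc_derivable.induct)
    case (assm c)
    have "ipc_derivable A (Imp a a)" by (meson imp_K imp_S MP)
    then show ?case using assm by (auto intro: ipc_derivable_weaken ipc_derivable.assm)
  next
    case (MP c d)
    then show ?case by (meson imp_S ipc_derivable.MP)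
  qed (rule ipc_derivable_weaken, rule ipc_derivable.intros)+
next
  assume "ipc_derivable A (Imp a b)"
  then have "ipc_derivable (insert a A) (Imp a b)" by (rule ipc_derivable_mono) blast
  then show "ipc_derivable (insert a A) b" by (rule MP) (simp add: assm)
qed

text \<open>A derivation uses finitely many axioms, and finitely many members of a chain have a
  largest one. This is the chain condition for Zorn's lemma in \<open>lindenbaum\<close>.\<close>

lemma ipc_derivable_Union_chain:
  assumes "ipc_derivable (\<Union>C) a" "C \<noteq> {}" and chain: "\<And>S T. S \<in> C \<Longrightarrow> T \<in> C \<Longrightarrow> S \<subseteq> T \<or> T \<subseteq> S"
  shows "\<exists>S\<in>C. ipc_derivable S a"
  using assms(1)
proof (induction rule: ipc_derivable.induct)
  case (assm a)
  then show ?case by (auto intro: ipc_derivable.assm)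
next
  case (MP a b)
  then obtain S T where ST: "S \<in> C" "ipc_derivable S (Imp a b)" "T \<in> C" "ipc_derivable T a" by blast
  then consider "S \<subseteq> T" | "T \<subseteq> S" using chain by blast
  then show ?case using ST by cases (meson ipc_derivable.MP ipc_derivable_mono)+
qed (use \<open>C \<noteq> {}\<close> in \<open>blast intro: ipc_derivable.intros\<close>)+

definition prime_theory :: "fm set \<Rightarrow> bool" where
  "prime_theory T \<longleftrightarrow> (\<forall>a. ipc_derivable T a \<longrightarrow> a \<in> T) \<and> Bot \<notin> T \<and>
     (\<forall>a b. Or a b \<in> T \<longrightarrow> a \<in> T \<or> b \<in> T)"

text \<open>T is maximal among the extensions of A that do not derive b. The last conclusion records
  this maximality; for \<open>b = Bot\<close> it says that T decides every formula.\<close>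

lemma lindenbaum:
  assumes "\<not> ipc_derivable A b"
  obtains T where "A \<subseteq> T" "prime_theory T" "b \<notin> T" "\<And>a. a \<notin> T \<Longrightarrow> Imp a b \<in> T"
proof -
  define \<T> where "\<T> = {T. A \<subseteq> T \<and> \<not> ipc_derivable T b}"
  have "\<exists>M\<in>\<T>. \<forall>X\<in>\<T>. M \<subseteq> X \<longrightarrow> X = M"
  proof (rule subset_Zorn_nonempty)
    show "\<T> \<noteq> {}" using assms by (auto simp: \<T>_def)
    fix C assume C: "C \<noteq> {}" "subset.chain \<T> C"
    have "S \<subseteq> T \<or> T \<subseteq> S" if "S \<in> C" "T \<in> C" for S T
      using C(2) that by (auto simp: subset_chain_def)
    moreover have "C \<subseteq> \<T>" using C(2) by (auto simp: subset_chain_def)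
    ultimately have "\<not> ipc_derivable (\<Union>C) b"
      using C(1) ipc_derivable_Union_chain[of C b] unfolding \<T>_def by blast
    then show "\<Union>C \<in> \<T>" using C(1) \<open>C \<subseteq> \<T>\<close> unfolding \<T>_def by blast
  qed
  then obtain T where "T \<in> \<T>" and mx: "\<forall>X\<in>\<T>. T \<subseteq> X \<longrightarrow> X = T" by blast
  then have T: "A \<subseteq> T" "\<not> ipc_derivable T b" by (simp_all add: \<T>_def)
  have imp: "ipc_derivable T (Imp a b)" if "a \<notin> T" for a
  proof (rule ccontr)
    assume "\<not> ?thesis"
    then have "insert a T \<in> \<T>" using T(1) deduction by (auto simp: \<T>_def)
    then show False using mx that by blast
  qed
  have closed: "a \<in> T" if "ipc_derivable T a" for a
    using imp T that MP by blast
  show thesis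
  proof
    show "A \<subseteq> T" by fact
    show "b \<notin> T" using T assm by blast
    show "Imp a b \<in> T" if "a \<notin> T" for a using imp[OF that] by (rule closed)
    have "a \<in> T \<or> c \<in> T" if "Or a c \<in> T" for a c
    proof (rule ccontr)
      assume "\<not> ?thesis"
      then have "ipc_derivable T (Imp a b)" "ipc_derivable T (Imp c b)" using imp by blast+
      then have "ipc_derivable T b" using assm[OF that] or_E[of T a b c] MP by blast
      then show False using T by blast
    qed
    moreover have "Bot \<notin> T" using T bot_E[of T b] MP assm by blast
    ultimately show "prime_theory T" using closed by (simp add: prime_theory_def)
  qed
qed

lemma prime_theoryD:
  assumes "prime_theory T"
  shows prime_theory_closed: "ipc_derivable T a \<Longrightarrow> a \<in> T"
    and prime_theory_Bot: "Bot \<notin> T"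
    and prime_theory_Or: "Or a b \<in> T \<longleftrightarrow> a \<in> T \<or> b \<in> T"
    and prime_theory_And: "And a b \<in> T \<longleftrightarrow> a \<in> T \<and> b \<in> T"
    and prime_theory_MP: "Imp a b \<in> T \<Longrightarrow> a \<in> T \<Longrightarrow> b \<in> T"
proof -
  have cl: "c \<in> T" if "ipc_derivable T c" for c using assms that by (simp add: prime_theory_def)
  show "ipc_derivable T a \<Longrightarrow> a \<in> T" by (rule cl)
  show "Bot \<notin> T" using assms by (simp add: prime_theory_def)
  show mp: "b \<in> T" if "Imp a b \<in> T" "a \<in> T" for a b using cl MP assm that by blast
  show "Or a b \<in> T \<longleftrightarrow> a \<in> T \<or> b \<in> T"
    using assms mp cl or_I1[of T a b] or_I2[of T b a] by (auto simp: prime_theory_def)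
  show "And a b \<in> T \<longleftrightarrow> a \<in> T \<and> b \<in> T"
    using mp cl and_I[of T a b] and_E1[of T a b] and_E2[of T a b] by blast
qed

lemma prime_theory_Imp_extend:
  assumes "prime_theory T" "Imp a b \<notin> T"
  obtains T' where "T \<subseteq> T'" "prime_theory T'" "a \<in> T'" "b \<notin> T'"
proof -
  have "\<not> ipc_derivable (insert a T) b" using assms deduction prime_theory_closed by blast
  then show thesis using that by (rule lindenbaum) auto
qed

lemma prime_theory_Disj: "prime_theory T \<Longrightarrow> Disj as \<in> T \<longleftrightarrow> (\<exists>a\<in>set as. a \<in> T)"
  by (induction as rule: Disj.induct) (auto simp: prime_theory_Bot prime_theory_Or)

lemma prime_theory_Conj: "prime_theory T \<Longrightarrow> Conj as \<in> T \<longleftrightarrow> (\<forall>a\<in>set as. a \<in> T)"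
  by (induction as rule: Conj.induct) (auto simp: prime_theory_And bot_E prime_theory_closed)

section \<open>Complete theories and their separation by formulas\<close>

definition complete_theory :: "fm set \<Rightarrow> bool" where
  "complete_theory M \<longleftrightarrow> prime_theory M \<and> (\<forall>a. a \<in> M \<or> Neg a \<in> M)"

text \<open>Complete theories are the maximal prime theories, so they become the maximal nodes of
  the canonical model.\<close>

lemma prime_theory_extend_complete:
  assumes "prime_theory T"
  obtains M where "T \<subseteq> M" "complete_theory M"
proof -
  have "\<not> ipc_derivable T Bot" using assms prime_theory_Bot prime_theory_closed by blast
  then show thesis using that by (rule lindenbaum) (auto simp: complete_theory_def)
qed

lemma complete_theory_Neg: "complete_theory M \<Longrightarrow> Neg a \<in> M \<longleftrightarrow> a \<notin> M"
  unfolding complete_theory_def using prime_theory_Bot prime_theory_MP by blast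

lemma complete_theory_subset_eq:
  assumes "complete_theory M" "complete_theory N" "M \<subseteq> N"
  shows "M = N"
  using assms complete_theory_Neg by blast

text \<open>Distinct complete theories are incomparable. A finite conjunction of formulas, each
  excluding one rival, isolates a single theory, and a disjunction of such conjunctions describes
  any subfamily.\<close>

lemma separating_formula:
  assumes fin: "finite \<M>" and com: "\<And>M. M \<in> \<M> \<Longrightarrow> complete_theory M"
  obtains p where "\<And>M. M \<in> \<M> \<Longrightarrow> p \<in> M \<longleftrightarrow> M \<in> \<A>"
proof -
  have pr: "prime_theory M" if "M \<in> \<M>" for M using com[OF that] by (simp add: complete_theory_def)
  obtain l where l: "set l = \<M>" using fin finite_list by blast
  have "\<exists>s. M \<noteq> N \<longrightarrow> s \<in> M \<and> s \<notin> N" if "M \<in> \<M>" "N \<in> \<M>" for M N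
    using complete_theory_subset_eq[OF com[OF that(1)] com[OF that(2)]] by blast
  then obtain s where s: "\<And>M N. M \<in> \<M> \<Longrightarrow> N \<in> \<M> \<Longrightarrow> M \<noteq> N \<Longrightarrow> s M N \<in> M \<and> s M N \<notin> N"
    by metis
  define \<chi> where "\<chi> M = Conj (map (s M) (filter (\<lambda>N. N \<noteq> M) l))" for M
  have \<chi>: "\<chi> M \<in> N \<longleftrightarrow> M = N" if "M \<in> \<M>" "N \<in> \<M>" for M N
  proof (cases "M = N")
    case True
    then show ?thesis unfolding \<chi>_def prime_theory_Conj[OF pr[OF that(2)]] using s that l by auto
  next
    case False
    then have "s M N \<notin> N" "N \<in> set (filter (\<lambda>N. N \<noteq> M) l)" using s that l by auto
    then show ?thesis unfolding \<chi>_def prime_theory_Conj[OF pr[OF that(2)]] using False by auto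
  qed
  show thesis
  proof
    fix M assume M: "M \<in> \<M>"
    show "Disj (map \<chi> (filter (\<lambda>M. M \<in> \<A>) l)) \<in> M \<longleftrightarrow> M \<in> \<A>"
      unfolding prime_theory_Disj[OF pr[OF M]] using \<chi> M l by auto
  qed
qed

lemma subst_Disj: "subst \<sigma> (Disj as) = Disj (map (subst \<sigma>) as)"
  by (induction as rule: Disj.induct) auto

lemma subst_Conj: "subst \<sigma> (Conj as) = Conj (map (subst \<sigma>) as)"
  by (induction as rule: Conj.induct) auto

text \<open>The converse use of antichains. It is stated for finite families because separation
  needs finiteness; the application picks one complete theory for each maximal node of a finite
  model.\<close>

lemma card_complete_theories_le:
  assumes T: "prime_theory T" "\<And>\<sigma>. subst \<sigma> (phi k) \<in> T"
    and k: "1 \<le> k" "k \<le> n choose (n div 2)" "1 \<le> n"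
    and \<M>: "finite \<M>" "\<And>M. M \<in> \<M> \<Longrightarrow> complete_theory M \<and> T \<subseteq> M"
  shows "card \<M> \<le> n"
proof (rule ccontr)
  assume "\<not> card \<M> \<le> n"
  then obtain \<N> where \<N>: "\<N> \<subseteq> \<M>" "card \<N> = Suc n" by (meson not_less_eq_eq obtain_subset_with_card_n)
  then obtain N where N: "N \<in> \<N>" by fastforce
  define \<N>' where "\<N>' = \<N> - {N}"
  have fin: "finite \<N>" "finite \<N>'" using \<N> \<M> finite_subset by (auto simp: \<N>'_def)
  have card: "card \<N>' = n" using N \<N> fin by (simp add: \<N>'_def)
  have com: "complete_theory M" "prime_theory M" "T \<subseteq> M" if "M \<in> \<N>" for M
    using that \<N> \<M>(2) by (auto simp: complete_theory_def)
  show False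
  proof (cases "k = 1")
    case True
    \<comment> \<open>For k = 1 two theories suffice: with p in N but not in \<open>N'\<close>,
      neither disjunct of weak excluded middle lies in both.\<close>
    obtain N' where N': "N' \<in> \<N>'" using card k(3) by fastforce
    obtain p where p: "\<And>M. M \<in> \<N> \<Longrightarrow> p \<in> M \<longleftrightarrow> M \<in> {N}" using separating_formula[OF fin(1) com(1)] by blast
    have "Or (Neg p) (Neg (Neg p)) \<in> T" using T(2)[of "\<lambda>_. p"] True by (simp add: phi_def)
    then have "Neg p \<in> T \<or> Neg (Neg p) \<in> T" using prime_theory_Or T(1) by blast
    moreover have "Neg p \<notin> N" "Neg (Neg p) \<notin> N'" 
      using complete_theory_Neg com N N' p by (auto simp: \<N>'_def)
    ultimately show False using com(3) N N' by (auto simp: \<N>'_def)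
  next
    case False
    have "k \<le> card {B. B \<subseteq> \<N>' \<and> card B = n div 2}" using n_subsets[OF fin(2)] card k by simp
    then obtain \<F> where \<F>: "\<F> \<subseteq> {B. B \<subseteq> \<N>' \<and> card B = n div 2}" "card \<F> = k" "finite \<F>"
      by (meson obtain_subset_with_card_n)
    then obtain B where B: "bij_betw B {1..k} \<F>" using ex_bij_betw_nat_finite_1 by blast
    have Bs: "B i \<subseteq> \<N>'" "card (B i) = n div 2" if "i \<in> {1..k}" for i
      using bij_betwE[OF B] \<F>(1) that by blast+
    \<comment> \<open>The complement is described, so that the negation of \<open>p i\<close> holds
      exactly in N and the members of \<open>B i\<close>.\<close>
    have "\<forall>i. \<exists>p. \<forall>M\<in>\<N>. p \<in> M \<longleftrightarrow> M \<in> - (insert N (B i))"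
      using separating_formula[OF fin(1) com(1)] by metis
    then obtain p where p: "\<And>i M. M \<in> \<N> \<Longrightarrow> p i \<in> M \<longleftrightarrow> M \<notin> insert N (B i)" by (auto simp: choice_iff)
    then have neg: "Neg (p i) \<in> M \<longleftrightarrow> M \<in> insert N (B i)" if "M \<in> \<N>" for i M
      using complete_theory_Neg com that by blast
    define D where "D = [Imp (Neg (Var i)) (Neg (Var j)). i \<leftarrow> [1..<Suc k], j \<leftarrow> [1..<Suc k], i \<noteq> j]"
    have "subst p (phi k) = Or (Disj (map (subst p) D)) (Neg (Conj [Neg (p i). i \<leftarrow> [1..<Suc k]]))"
      using False by (simp add: phi_def D_def subst_Disj subst_Conj comp_def del: upt_Suc)
    then have "Disj (map (subst p) D) \<in> T \<or> Neg (Conj [Neg (p i). i \<leftarrow> [1..<Suc k]]) \<in> T"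
      using T prime_theory_Or by metis
    then show False
    proof
      assume "Disj (map (subst p) D) \<in> T"
      then obtain i j where ij: "i \<in> {1..k}" "j \<in> {1..k}" "i \<noteq> j" "Imp (Neg (p i)) (Neg (p j)) \<in> T"
        unfolding prime_theory_Disj[OF T(1)] D_def set_map set_phi_disjuncts by auto
      \<comment> \<open>Distinct finite sets of equal size are incomparable, and a theory in
        \<open>B i\<close> outside \<open>B j\<close> violates the implication.\<close>
      then have "B i \<noteq> B j" using inj_onD[OF bij_betw_imp_inj_on[OF B]] by blast
      moreover have "finite (B j)" using Bs[OF ij(2)] fin finite_subset by blast
      ultimately have "\<not> B i \<subseteq> B j" using Bs ij card_subset_eq by metis
      then obtain M where M: "M \<in> B i" "M \<notin> B j" by blast
      then have "M \<in> \<N>" "M \<noteq> N" using Bs ij by (auto simp: \<N>'_def)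
      moreover have "Neg (p i) \<in> M" "Neg (p j) \<notin> M" using neg M calculation by auto
      ultimately show False using com ij(4) prime_theory_MP by blast
    next
      assume "Neg (Conj [Neg (p i). i \<leftarrow> [1..<Suc k]]) \<in> T"
      \<comment> \<open>N was added to every set in order to defeat this last disjunct.\<close>
      moreover have "Conj [Neg (p i). i \<leftarrow> [1..<Suc k]] \<in> N"
        unfolding prime_theory_Conj[OF com(2)[OF N]] using neg N by (simp del: upt_Suc)
      ultimately show False using com N complete_theory_Neg by blast
    qed
  qed
qed

section \<open>Recursive functions and predicates\<close>

text \<open>Since \<^const>\<open>recursive_fun\<close> also fixes the values on argument lists of the wrong length, its closure
  properties are only usable up to agreement on lists of the right length.\<close>

definition recf :: "nat \<Rightarrow> (nat list \<Rightarrow> nat) \<Rightarrow> bool" where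
  "recf n f \<longleftrightarrow> (\<exists>g. recursive_fun n g \<and> (\<forall>xs. length xs = n \<longrightarrow> g xs = f xs))"

definition recp :: "nat \<Rightarrow> (nat list \<Rightarrow> bool) \<Rightarrow> bool" where
  "recp n P \<longleftrightarrow> recf n (\<lambda>xs. of_bool (P xs))"

lemma recfI: "recursive_fun n g \<Longrightarrow> (\<And>xs. length xs = n \<Longrightarrow> g xs = f xs) \<Longrightarrow> recf n f"
  unfolding recf_def by blast

lemma recf_cong: "recf n g \<Longrightarrow> (\<And>xs. length xs = n \<Longrightarrow> g xs = f xs) \<Longrightarrow> recf n f"
  unfolding recf_def by metis

lemma recf_comp:
  assumes "recf (length gs) f" and "\<And>g. g \<in> set gs \<Longrightarrow> recf n g"
  shows "recf n (\<lambda>xs. f (map (\<lambda>g. g xs) gs))"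
proof -
  obtain f' where f': "recursive_fun (length gs) f'" "\<And>xs. length xs = length gs \<Longrightarrow> f' xs = f xs"
    using assms(1) unfolding recf_def by blast
  obtain G where G: "\<And>g. g \<in> set gs \<Longrightarrow> recursive_fun n (G g)"
    "\<And>g xs. g \<in> set gs \<Longrightarrow> length xs = n \<Longrightarrow> G g xs = g xs"
    using assms(2) unfolding recf_def by metis
  have "recursive_fun n (\<lambda>xs. f' (map (\<lambda>g. g xs) (map G gs)))"
    using f' G by (intro recursive_fun.comp) auto
  then show ?thesis
  proof (rule recfI)
    fix xs :: "nat list" assume "length xs = n"
    then have eq: "map (\<lambda>g. g xs) (map G gs) = map (\<lambda>g. g xs) gs" using G(2) by auto
    show "f' (map (\<lambda>g. g xs) (map G gs)) = f (map (\<lambda>g. g xs) gs)"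
      unfolding eq by (rule f'(2)) simp
  qed
qed

lemma recf_nth: "i < n \<Longrightarrow> recf n (\<lambda>xs. xs ! i)"
  by (rule recfI[OF recursive_fun.proj]) auto

text \<open>Arguments may be permuted, repeated or dropped; passing under a bound variable is a case
  of this.\<close>

lemma recf_reindex:
  assumes "recf (length is) f" "\<And>i. i \<in> set is \<Longrightarrow> i < n"
  shows "recf n (\<lambda>xs. f (map (\<lambda>i. xs ! i) is))"
proof -
  have "recf n g" if "g \<in> set (map (\<lambda>i xs. xs ! i) is)" for g
    using that assms(2) recf_nth by auto
  then show ?thesis using recf_comp[of "map (\<lambda>i xs. xs ! i) is" f n] assms(1) by (simp add: comp_def)
qed

lemma recf_tl: assumes "recf n f" shows "recf (Suc n) (\<lambda>xs. f (tl xs))"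
proof (rule recf_cong[OF recf_reindex[of "[1..<Suc n]"]])
  show "f (map ((!) xs) [1..<Suc n]) = f (tl xs)" if "length xs = Suc n" for xs
    using that by (auto intro!: arg_cong[of _ _ f] nth_equalityI simp: nth_tl simp del: upt_Suc)
qed (use assms in \<open>auto simp del: upt_Suc\<close>)

text \<open>The step function of a recursion receives the counter and the previous value before the
  parameters. A summand depends on the counter and the parameters alone and has to skip the second
  entry.\<close>

lemma recf_drop_snd:
  assumes "recf (Suc n) (\<lambda>xs. f (hd xs) (tl xs))"
  shows "recf (Suc (Suc n)) (\<lambda>xs. f (hd xs) (tl (tl xs)))"
proof (rule recf_cong[OF recf_reindex[of "0 # [2..<Suc (Suc n)]"]])
  show "(\<lambda>xs. f (hd xs) (tl xs)) (map ((!) xs) (0 # [2..<Suc (Suc n)])) = f (hd xs) (tl (tl xs))"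
    if "length xs = Suc (Suc n)" for xs
  proof -
    have "map ((!) xs) [2..<Suc (Suc n)] = tl (tl xs)"
      using that by (intro nth_equalityI) (auto simp: nth_tl simp del: upt_Suc)
    moreover have "xs ! 0 = hd xs" using that by (cases xs) auto
    ultimately show ?thesis by (simp del: upt_Suc)
  qed
qed (use assms in \<open>auto simp del: upt_Suc\<close>)

lemma recf_let:
  assumes "recf (Suc n) (\<lambda>xs. f (hd xs) (tl xs))" "recf n g"
  shows "recf n (\<lambda>xs. f (g xs) xs)"
proof (rule recf_cong[OF recf_comp[of "g # map (\<lambda>i xs. xs ! i) [0..<n]"]])
  show "(\<lambda>xs. f (hd xs) (tl xs)) (map (\<lambda>g. g xs) (g # map (\<lambda>i xs. xs ! i) [0..<n])) = f (g xs) xs"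
    if "length xs = n" for xs
    using that map_nth[of xs] by (simp add: comp_def)
qed (use assms recf_nth in auto)

lemma recf_hd: "recf (Suc n) (\<lambda>xs. hd xs)"
  by (rule recf_cong[OF recf_nth[of 0]]) (simp, metis hd_conv_nth length_0_conv nat.simps(3))

text \<open>Bound variables are de Bruijn indices into the argument list, the innermost at the head.
  Six positions cover the quantifier nesting in \<open>recp_countermodel\<close>.\<close>

lemmas recf_vars = recf_hd recf_tl[OF recf_hd] recf_tl[OF recf_tl[OF recf_hd]]
  recf_tl[OF recf_tl[OF recf_tl[OF recf_hd]]] recf_tl[OF recf_tl[OF recf_tl[OF recf_tl[OF recf_hd]]]]
  recf_tl[OF recf_tl[OF recf_tl[OF recf_tl[OF recf_tl[OF recf_hd]]]]]

text \<open>By \<open>recf_let\<close> the number of iterations may be any recursive function of the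
  parameters instead of the first argument.\<close>

lemma recf_rec:
  assumes "recf n b" "recf n f" "recf (Suc (Suc n)) (\<lambda>xs. g (hd xs) (hd (tl xs)) (tl (tl xs)))"
  shows "recf n (\<lambda>xs. rec_nat (f xs) (\<lambda>m r. g m r xs) (b xs))"
proof -
  obtain f' where f': "recursive_fun n f'" "\<And>xs. length xs = n \<Longrightarrow> f' xs = f xs"
    using assms(2) unfolding recf_def by blast
  obtain g' where g': "recursive_fun (Suc (Suc n)) g'"
    "\<And>xs. length xs = Suc (Suc n) \<Longrightarrow> g' xs = g (hd xs) (hd (tl xs)) (tl (tl xs))"
    using assms(3) unfolding recf_def by blast
  have "recf (Suc n) (\<lambda>xs. rec_nat (f (tl xs)) (\<lambda>m r. g m r (tl xs)) (hd xs))"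
    by (rule recfI[OF recursive_fun.prim_rec[OF f'(1) g'(1)]]) (simp add: f' g')
  then show ?thesis using assms(1) by (rule recf_let)
qed

section \<open>Arithmetic functions, pairing and finite sums\<close>

lemma recf_Suc:
  assumes "recf n f" shows "recf n (\<lambda>xs. Suc (f xs))"
proof -
  have "recf 1 (\<lambda>xs. Suc (xs ! 0))" by (rule recfI[OF recursive_fun.succ]) simp
  then show ?thesis using recf_comp[of "[f]" "\<lambda>xs. Suc (xs ! 0)" n] assms by simp
qed

lemma recf_const: "recf n (\<lambda>xs. k)"
proof (induction k)
  case 0
  show ?case by (rule recfI[OF recursive_fun.zero]) simp
qed (rule recf_Suc)

lemma recf_add:
  assumes "recf n f" "recf n g" shows "recf n (\<lambda>xs. f xs + g xs)"
proof -
  have "rec_nat a (\<lambda>m r. Suc r) b = a + b" for a b :: nat by (induction b) auto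
  then show ?thesis using recf_rec[OF assms(2,1), of "\<lambda>m r xs. Suc r"] by (simp add: recf_Suc recf_vars)
qed

lemma recf_mult:
  assumes "recf n f" "recf n g" shows "recf n (\<lambda>xs. f xs * g xs)"
proof -
  have "rec_nat 0 (\<lambda>m r. r + a) b = a * b" for a b :: nat by (induction b) auto
  then show ?thesis using recf_rec[OF assms(2) recf_const[of _ 0], of "\<lambda>m r xs. r + f xs"]
    by (simp add: recf_add[OF recf_vars(2) recf_tl[OF recf_tl[OF assms(1)]]])
qed

lemma recf_diff:
  assumes "recf n f" "recf n g" shows "recf n (\<lambda>xs. f xs - g xs)"
proof -
  have "rec_nat 0 (\<lambda>m r. m) a = a - 1" for a :: nat by (cases a) auto
  then have pred: "recf n (\<lambda>xs. h xs - 1)" if "recf n h" for n h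
    using recf_rec[OF that recf_const[of _ 0], of "\<lambda>m r xs. m"] by (simp add: recf_vars)
  have "rec_nat a (\<lambda>m r. r - 1) b = a - b" for a b :: nat by (induction b) auto
  then show ?thesis using recf_rec[OF assms(2,1), of "\<lambda>m r xs. r - 1"] pred[OF recf_vars(2)] by simp
qed

lemma recf_pow2:
  assumes "recf n f" shows "recf n (\<lambda>xs. 2 ^ f xs)"
proof -
  have "rec_nat 1 (\<lambda>m r. r + r) a = (2 ^ a :: nat)" for a by (induction a) auto
  then show ?thesis using recf_rec[OF assms recf_const[of _ 1], of "\<lambda>m r xs. r + r"]
    by (simp add: recf_add recf_vars)
qed

lemma recf_div_pow2:
  assumes "recf n f" "recf n g" shows "recf n (\<lambda>xs. f xs div 2 ^ g xs)"
proof -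
  \<comment> \<open>Halving by recursion: \<open>Suc m div 2 = m - m div 2\<close>.\<close>
  have "rec_nat 0 (\<lambda>m r. m - r) a = a div 2" for a :: nat by (induction a) auto
  then have half: "recf n (\<lambda>xs. h xs div 2)" if "recf n h" for n h
    using recf_rec[OF that recf_const[of _ 0], of "\<lambda>m r xs. m - r"] by (simp add: recf_diff recf_vars)
  have "rec_nat a (\<lambda>m r. r div 2) b = a div 2 ^ b" for a b :: nat
    by (induction b) (auto simp: div_mult2_eq[symmetric] mult.commute)
  then show ?thesis using recf_rec[OF assms(2,1), of "\<lambda>m r xs. r div 2"] half[OF recf_vars(2)] by simp
qed

lemma recf_prod_encode:
  assumes "recf n f" "recf n g" shows "recf n (\<lambda>xs. prod_encode (f xs, g xs))"
proof -
  have "rec_nat 0 (\<lambda>m r. r + Suc m) a = triangle a" for a by (induction a) auto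
  then have "recf n (\<lambda>xs. triangle (h xs))" if "recf n h" for h
    using recf_rec[OF that recf_const[of _ 0], of "\<lambda>m r xs. r + Suc m"]
    by (simp add: recf_add recf_Suc recf_vars del: add_Suc_right)
  then show ?thesis using assms by (simp add: prod_encode_def recf_add)
qed

text \<open>Finite sums serve twice: for bounded quantifiers and for counting maximal nodes.\<close>

lemma recf_sum:
  assumes "recf n b" "recf (Suc n) (\<lambda>xs. f (hd xs) (tl xs))"
  shows "recf n (\<lambda>xs. \<Sum>m<b xs. f m xs)"
proof -
  have "rec_nat 0 (\<lambda>m r. r + h m) a = (\<Sum>m<a. h m)" for h :: "nat \<Rightarrow> nat" and a
    by (induction a) auto
  then show ?thesis using recf_rec[OF assms(1) recf_const[of _ 0], of "\<lambda>m r xs. r + f m xs"]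
    by (simp add: recf_add recf_vars recf_drop_snd assms)
qed

section \<open>Recursive predicates and bounded quantification\<close>

lemma recf_of_bool: "recp n P \<Longrightarrow> recf n (\<lambda>xs. of_bool (P xs))"
  by (simp add: recp_def)

lemma recp_odd:
  assumes "recf n f" shows "recp n (\<lambda>xs. odd (f xs))"
proof -
  have "rec_nat 0 (\<lambda>m r. 1 - r) a = (of_bool (odd a) :: nat)" for a :: nat by (induction a) auto
  then show ?thesis using recf_rec[OF assms recf_const[of _ 0], of "\<lambda>m r xs. 1 - r"]
    by (simp add: recp_def recf_diff[OF recf_const] recf_vars del: One_nat_def)
qed

lemma recp_not: "recp n P \<Longrightarrow> recp n (\<lambda>xs. \<not> P xs)"
  using recf_diff[OF recf_const[of n 1], of "\<lambda>xs. of_bool (P xs)"]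
  by (auto simp: recp_def elim: recf_cong)

lemma recp_conj: "recp n P \<Longrightarrow> recp n Q \<Longrightarrow> recp n (\<lambda>xs. P xs \<and> Q xs)"
  unfolding recp_def of_bool_conj by (rule recf_mult)

lemma recp_imp: "recp n P \<Longrightarrow> recp n Q \<Longrightarrow> recp n (\<lambda>xs. P xs \<longrightarrow> Q xs)"
  using recp_not[OF recp_conj[OF _ recp_not], of n P Q] by simp

lemma recp_disj: "recp n P \<Longrightarrow> recp n Q \<Longrightarrow> recp n (\<lambda>xs. P xs \<or> Q xs)"
  using recp_imp[OF recp_not, of n P Q] by (simp add: imp_conv_disj)

lemma recp_iff: "recp n P \<Longrightarrow> recp n Q \<Longrightarrow> recp n (\<lambda>xs. P xs \<longleftrightarrow> Q xs)"
  using recp_conj[OF recp_imp recp_imp, of n P Q Q P] by (simp add: iff_conv_conj_imp)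

lemma recp_le:
  assumes "recf n f" "recf n g" shows "recp n (\<lambda>xs. f xs \<le> g xs)"
proof -
  have "of_bool (a \<le> b) = 1 - (a - b)" for a b :: nat by auto
  then show ?thesis using assms by (simp only: recp_def) (intro recf_diff recf_const)
qed

lemma recp_less: "recf n f \<Longrightarrow> recf n g \<Longrightarrow> recp n (\<lambda>xs. f xs < g xs)"
  unfolding less_eq_Suc_le by (intro recp_le recf_Suc)

lemma recp_eq: "recf n f \<Longrightarrow> recf n g \<Longrightarrow> recp n (\<lambda>xs. f xs = g xs)"
  unfolding order_eq_iff by (intro recp_conj recp_le)

lemma recp_ex_less:
  assumes "recf n b" "recp (Suc n) (\<lambda>xs. P (hd xs) (tl xs))"
  shows "recp n (\<lambda>xs. \<exists>m<b xs. P m xs)"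
proof -
  have "(\<exists>m<b xs. P m xs) \<longleftrightarrow> 0 < (\<Sum>m<b xs. of_bool (P m xs) :: nat)" for xs
    by (auto simp: sum_pos2 zero_less_iff_neq_zero)
  then show ?thesis using assms
    by (simp only: recp_def[of "Suc n"]) (intro recp_less recf_const recf_sum)
qed

lemma recp_all_less:
  assumes "recf n b" "recp (Suc n) (\<lambda>xs. P (hd xs) (tl xs))"
  shows "recp n (\<lambda>xs. \<forall>m<b xs. P m xs)"
  using recp_not[OF recp_ex_less[OF assms(1) recp_not[OF assms(2)]]] by simp

lemma recp_mem_set_decode:
  assumes "recf n f" "recf n g" shows "recp n (\<lambda>xs. f xs \<in> set_decode (g xs))"
  unfolding set_decode_def mem_Collect_eq by (intro recp_odd recf_div_pow2 assms)

lemmas rec_intros = recp_not recp_conj recp_imp recp_disj recp_iff recp_le recp_less recp_eq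
  recp_ex_less recp_all_less recp_mem_set_decode recf_of_bool recf_sum recf_prod_encode recf_pow2
  recf_add recf_mult recf_Suc recf_const recf_vars

lemma recursive_set_if_recp:
  assumes "recp 1 (\<lambda>xs. hd xs \<in> A)" shows "recursive_set A"
proof -
  obtain g where "recursive_fun 1 g" "\<And>xs. length xs = 1 \<Longrightarrow> g xs = of_bool (hd xs \<in> A)"
    using assms unfolding recp_def recf_def by blast
  then show ?thesis unfolding recursive_set_def by (intro exI[of _ g]) simp
qed

section \<open>Finite countermodels\<close>

text \<open>A finite Kripke countermodel to the formula with code \<open>c\<close>, ordered by inclusion: every node is
  the set of codes \<open>\<le> c\<close> of the formulas that it forces.\<close>

definition countermodel :: "nat \<Rightarrow> nat \<Rightarrow> nat set set \<Rightarrow> bool" where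
  "countermodel n c W \<longleftrightarrow> W \<subseteq> Pow {..c} \<and> (\<exists>D\<in>W. c \<notin> D \<and> (\<forall>E\<in>W. D \<subseteq> E)) \<and>
     card {D\<in>W. \<forall>E\<in>W. D \<subseteq> E \<longrightarrow> E = D} \<le> n \<and>
     (\<forall>D\<in>W. 0 \<notin> D \<and> (\<forall>x<c. \<forall>y<c.
        (Suc (4 * prod_encode (x, y) + 1) \<le> c \<longrightarrow>
          (Suc (4 * prod_encode (x, y) + 1) \<in> D \<longleftrightarrow> x \<in> D \<and> y \<in> D)) \<and>
        (Suc (4 * prod_encode (x, y) + 2) \<le> c \<longrightarrow>
          (Suc (4 * prod_encode (x, y) + 2) \<in> D \<longleftrightarrow> x \<in> D \<or> y \<in> D)) \<and>
        (Suc (4 * prod_encode (x, y) + 3) \<le> c \<longrightarrow>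
          (Suc (4 * prod_encode (x, y) + 3) \<in> D \<longleftrightarrow> (\<forall>E\<in>W. D \<subseteq> E \<longrightarrow> x \<in> E \<longrightarrow> y \<in> E)))))"

lemma countermodel_subset: "countermodel n c W \<Longrightarrow> W \<subseteq> Pow {..c}"
  by (simp only: countermodel_def)

text \<open>The closure conditions of \<open>countermodel\<close> are the forcing clauses read on
  codes, so membership of a code and forcing of its formula agree.\<close>

lemma countermodel_refutes:
  assumes W: "countermodel n (fm_code a) W"
  defines "R \<equiv> {(D, E). D \<in> W \<and> E \<in> W \<and> D \<subseteq> E}"
  shows "kripke_frame W R" "finite W" "topwidth_at_most W R n" "\<not> holds_in W R a"
proof -
  let ?c = "fm_code a"
  have Wc: "W \<subseteq> Pow {..?c}" using W by (rule countermodel_subset)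
  then show fin: "finite W" by (meson finite_Pow_iff finite_atMost finite_subset)
  have "\<exists>r\<in>W. ?c \<notin> r \<and> (\<forall>E\<in>W. r \<subseteq> E)" using W by (simp only: countermodel_def)
  then obtain r where r: "r \<in> W" "?c \<notin> r" "\<And>E. E \<in> W \<Longrightarrow> r \<subseteq> E" by blast
  have po: "partial_order_on W R"
    unfolding R_def partial_order_on_def preorder_on_def refl_on_def trans_def antisym_def by auto
  then show "kripke_frame W R" using r unfolding kripke_frame_def by (auto simp: R_def)
  have mx: "maximal_nodes W R = {D\<in>W. \<forall>E\<in>W. D \<subseteq> E \<longrightarrow> E = D}"
    by (auto simp: maximal_nodes_def R_def)
  have "\<exists>E\<in>maximal_nodes W R. (D, E) \<in> R" if D: "D \<in> W" for D
  proof -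
    obtain E where "E \<in> W" "D \<subseteq> E" "\<forall>F\<in>W. E \<subseteq> F \<longrightarrow> E = F"
      using finite_has_maximal2[OF fin D] by auto
    then show ?thesis using D unfolding mx by (auto simp: R_def)
  qed
  moreover have "card (maximal_nodes W R) \<le> n" "finite (maximal_nodes W R)"
    using W fin unfolding mx by (simp_all add: countermodel_def)
  ultimately show "topwidth_at_most W R n" by (auto simp: topwidth_at_most_def has_topwidth_def)
  define V where "V p = {D\<in>W. fm_code (Var p) \<in> D}" for p
  have "valuation W R V" by (auto simp: valuation_def V_def R_def)
  have closed:
      "Suc (4 * prod_encode (x, y) + 1) \<le> ?c \<Longrightarrow>
        (Suc (4 * prod_encode (x, y) + 1) \<in> D \<longleftrightarrow> x \<in> D \<and> y \<in> D)"
      "Suc (4 * prod_encode (x, y) + 2) \<le> ?c \<Longrightarrow>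
        (Suc (4 * prod_encode (x, y) + 2) \<in> D \<longleftrightarrow> x \<in> D \<or> y \<in> D)"
      "Suc (4 * prod_encode (x, y) + 3) \<le> ?c \<Longrightarrow>
        (Suc (4 * prod_encode (x, y) + 3) \<in> D \<longleftrightarrow> (\<forall>E\<in>W. D \<subseteq> E \<longrightarrow> x \<in> E \<longrightarrow> y \<in> E))"
    if "D \<in> W" "x < ?c" "y < ?c" for D x y
    using W that by (simp_all only: countermodel_def)
  \<comment> \<open>The induction stays among codes up to c because a compound formula has a larger
    code than its components.\<close>
  have truth: "forces W R V D b \<longleftrightarrow> fm_code b \<in> D" if "fm_code b \<le> ?c" "D \<in> W" for D b
    using that
  proof (induction b arbitrary: D)
    case Bot
    then show ?case using W by (simp add: countermodel_def)
  next
    case (Var p)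
    then show ?case by (simp add: V_def)
  next
    case (And b1 b2)
    have lt: "fm_code b1 < ?c" "fm_code b2 < ?c"
      using And.prems(1) le_prod_encode_1[of "fm_code b1" "fm_code b2"]
        le_prod_encode_2[of "fm_code b2" "fm_code b1"] by simp_all
    have "fm_code (And b1 b2) \<in> D \<longleftrightarrow> fm_code b1 \<in> D \<and> fm_code b2 \<in> D"
      using closed[OF And.prems(2) lt] And.prems(1) by (simp only: fm_code.simps)
    then show ?case using And lt by simp
  next
    case (Or b1 b2)
    have lt: "fm_code b1 < ?c" "fm_code b2 < ?c"
      using Or.prems(1) le_prod_encode_1[of "fm_code b1" "fm_code b2"]
        le_prod_encode_2[of "fm_code b2" "fm_code b1"] by simp_all
    have "fm_code (Or b1 b2) \<in> D \<longleftrightarrow> fm_code b1 \<in> D \<or> fm_code b2 \<in> D"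
      using closed[OF Or.prems(2) lt] Or.prems(1) by (simp only: fm_code.simps)
    then show ?case using Or lt by simp
  next
    case (Imp b1 b2)
    have lt: "fm_code b1 < ?c" "fm_code b2 < ?c"
      using Imp.prems(1) le_prod_encode_1[of "fm_code b1" "fm_code b2"]
        le_prod_encode_2[of "fm_code b2" "fm_code b1"] by simp_all
    have "fm_code (Imp b1 b2) \<in> D \<longleftrightarrow>
        (\<forall>E\<in>W. D \<subseteq> E \<longrightarrow> fm_code b1 \<in> E \<longrightarrow> fm_code b2 \<in> E)"
      using closed[OF Imp.prems(2) lt] Imp.prems(1) by (simp only: fm_code.simps)
    then show ?case using Imp lt by (simp add: R_def)
  qed
  then have "\<not> forces W R V r a" using r by simp
  then show "\<not> holds_in W R a" using \<open>valuation W R V\<close> r unfolding holds_in_def by blast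
qed

text \<open>A filtration of the canonical model: prime theories above T are identified when they
  contain the same formulas with code at most c, and are ordered by inclusion of these
  traces.\<close>

lemma countermodel_if_not_derivable:
  assumes k: "1 \<le> k" "k \<le> n choose (n div 2)" "1 \<le> n" and a: "a \<notin> IPC_plus (phi k)"
  shows "\<exists>W. countermodel n (fm_code a) W"
proof -
  let ?c = "fm_code a"
  have "\<not> ipc_derivable {subst \<sigma> (phi k) | \<sigma>. True} a" using a by (simp add: IPC_plus_def)
  then obtain T where T: "{subst \<sigma> (phi k) | \<sigma>. True} \<subseteq> T" "prime_theory T" "a \<notin> T"
    by (rule lindenbaum)
  define tr where "tr S = fm_code ` S \<inter> {..?c}" for S
  define W where "W = {tr S | S. prime_theory S \<and> T \<subseteq> S}"
  have inj: "inj fm_code" using bij_fm_code by (rule bij_is_inj)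
  then have tr: "fm_code b \<in> tr S \<longleftrightarrow> b \<in> S" if "fm_code b \<le> ?c" for b S
    using that by (auto simp: tr_def inj_image_mem_iff)
  have tr_sub: "tr S \<subseteq> {..?c}" for S by (auto simp: tr_def)
  have WI: "tr S \<in> W" if "prime_theory S" "T \<subseteq> S" for S using that by (auto simp: W_def)
  have fin: "finite W" by (rule finite_subset[of _ "Pow {..?c}"]) (use tr_sub in \<open>auto simp: W_def\<close>)
  define X where "X = {D\<in>W. \<forall>E\<in>W. D \<subseteq> E \<longrightarrow> E = D}"
  \<comment> \<open>Passing from S to a complete extension can only enlarge the trace, and a maximal
    trace cannot grow.\<close>
  have "\<exists>M. complete_theory M \<and> T \<subseteq> M \<and> tr M = D" if D: "D \<in> X" for D
  proof -
    obtain S where S: "prime_theory S" "T \<subseteq> S" "D = tr S" using D by (auto simp: X_def W_def)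
    obtain M where M: "S \<subseteq> M" "complete_theory M" using prime_theory_extend_complete[OF S(1)] by blast
    then have "tr M \<in> W" using S by (intro WI) (auto simp: complete_theory_def)
    moreover have "D \<subseteq> tr M" using S M by (auto simp: tr_def)
    ultimately have "tr M = D" using D by (simp add: X_def)
    then show ?thesis using M S by blast
  qed
  then obtain M where M: "\<And>D. D \<in> X \<Longrightarrow> complete_theory (M D) \<and> T \<subseteq> M D \<and> tr (M D) = D" by metis
  have "inj_on M X" by (metis M inj_onI)
  then have "card X = card (M ` X)" by (simp add: card_image)
  also have "\<dots> \<le> n"
  proof (rule card_complete_theories_le[OF T(2) _ k])
    show "finite (M ` X)" using fin by (simp add: X_def)
  qed (use T(1) M in auto)
  finally have "card X \<le> n" .
  have "countermodel n ?c W"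
    unfolding countermodel_def
  proof (intro conjI ballI allI impI)
    show "W \<subseteq> Pow {..?c}" using tr_sub by (auto simp: W_def)
    show "\<exists>D\<in>W. ?c \<notin> D \<and> (\<forall>E\<in>W. D \<subseteq> E)"
    proof (intro bexI conjI ballI)
      show "?c \<notin> tr T" using tr T(3) by blast
      show "tr T \<in> W" using T(2) by (intro WI) auto
      show "tr T \<subseteq> E" if "E \<in> W" for E using that by (auto simp: W_def tr_def)
    qed
    show "card {D\<in>W. \<forall>E\<in>W. D \<subseteq> E \<longrightarrow> E = D} \<le> n" using \<open>card X \<le> n\<close> by (simp add: X_def)
    fix D assume "D \<in> W"
    then obtain S where S: "prime_theory S" "T \<subseteq> S" "D = tr S" by (auto simp: W_def)
    show "0 \<notin> D" using tr[of Bot S] prime_theory_Bot S by simp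
    fix x y assume "x < ?c" "y < ?c"
    obtain b d where xy: "x = fm_code b" "y = fm_code d" using bij_fm_code by (metis bij_pointE)
    have b: "fm_code b \<in> tr U \<longleftrightarrow> b \<in> U" and d: "fm_code d \<in> tr U \<longleftrightarrow> d \<in> U" for U
      using tr xy \<open>x < ?c\<close> \<open>y < ?c\<close> by simp_all
    show "Suc (4 * prod_encode (x, y) + 1) \<in> D \<longleftrightarrow> x \<in> D \<and> y \<in> D"
      if "Suc (4 * prod_encode (x, y) + 1) \<le> ?c"
      using that tr[of "And b d" S] b d prime_theory_And[OF S(1)] unfolding S(3) xy fm_code.simps by blast
    show "Suc (4 * prod_encode (x, y) + 2) \<in> D \<longleftrightarrow> x \<in> D \<or> y \<in> D"
      if "Suc (4 * prod_encode (x, y) + 2) \<le> ?c"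
      using that tr[of "Or b d" S] b d prime_theory_Or[OF S(1)] unfolding S(3) xy fm_code.simps by blast
    show "Suc (4 * prod_encode (x, y) + 3) \<in> D \<longleftrightarrow> (\<forall>E\<in>W. D \<subseteq> E \<longrightarrow> x \<in> E \<longrightarrow> y \<in> E)"
      if c: "Suc (4 * prod_encode (x, y) + 3) \<le> ?c"
    proof -
      have imp: "fm_code (Imp b d) \<in> tr U \<longleftrightarrow> Imp b d \<in> U" for U
        using c tr[of "Imp b d" U] unfolding xy fm_code.simps by blast
      have "(\<forall>E\<in>W. D \<subseteq> E \<longrightarrow> x \<in> E \<longrightarrow> y \<in> E) \<longleftrightarrow> Imp b d \<in> S"
      proof
        assume l: "\<forall>E\<in>W. D \<subseteq> E \<longrightarrow> x \<in> E \<longrightarrow> y \<in> E"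
        show "Imp b d \<in> S"
        proof (rule ccontr)
          assume "Imp b d \<notin> S"
          then obtain S' where S': "S \<subseteq> S'" "prime_theory S'" "b \<in> S'" "d \<notin> S'"
            using prime_theory_Imp_extend[OF S(1)] by blast
          then have "tr S' \<in> W" using S(2) by (intro WI) auto
          moreover have "D \<subseteq> tr S'" using S(3) S'(1) by (auto simp: tr_def)
          ultimately show False using l b d S' unfolding xy by blast
        qed
      next
        assume bd: "Imp b d \<in> S"
        show "\<forall>E\<in>W. D \<subseteq> E \<longrightarrow> x \<in> E \<longrightarrow> y \<in> E"
        proof (intro ballI impI)
          fix E assume E: "E \<in> W" "D \<subseteq> E" "x \<in> E"
          then obtain U where U: "prime_theory U" "E = tr U" by (auto simp: W_def)
          \<comment> \<open>Only the traces of S and U are known to be included in each other, but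
            the implication has code at most c and so belongs to the trace.\<close>
          then have "Imp b d \<in> U" using bd imp E S(3) by blast
          moreover have "b \<in> U" using E(3) b U(2) xy by simp
          ultimately have "d \<in> U" by (rule prime_theory_MP[OF U(1)])
          then show "y \<in> E" using d U(2) xy by simp
        qed
      qed
      then show ?thesis using imp unfolding S(3) xy fm_code.simps by blast
    qed
  qed
  then show ?thesis ..
qed

section \<open>Bounded search over binary codes of families of sets\<close>

lemma le_if_mem_set_decode: assumes "x \<in> set_decode d" shows "2 ^ x \<le> d"
proof (rule ccontr)
  assume "\<not> 2 ^ x \<le> d"
  then have "d div 2 ^ x = 0" by simp
  then show False using assms by (simp add: set_decode_def)
qed

lemma set_encode_less: assumes "A \<subseteq> {..<m}" shows "set_encode A < 2 ^ m"
proof -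
  have "set_encode A \<le> (\<Sum>i<m. 2 ^ i)" unfolding set_encode_def by (rule sum_mono2) (use assms in auto)
  also have "\<dots> < 2 ^ m" by (induction m) auto
  finally show ?thesis .
qed

text \<open>Nodes and families of nodes are coded by the binary expansions of natural numbers.\<close>

definition nodes :: "nat \<Rightarrow> nat \<Rightarrow> nat set set" where
  "nodes c w = set_decode ` {d. d < 2 ^ Suc c \<and> d \<in> set_decode w}"

lemma nodes_subset: "nodes c w \<subseteq> Pow {..c}"
proof -
  have "x \<le> c" if "d < 2 ^ Suc c" "x \<in> set_decode d" for d x
  proof -
    have "2 ^ x < (2 :: nat) ^ Suc c" using le_if_mem_set_decode[OF that(2)] that(1) by simp
    then show ?thesis using power_less_imp_less_exp[of "2 :: nat" x "Suc c"] by simp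
  qed
  then show ?thesis unfolding nodes_def by auto
qed

text \<open>The search bound: subsets of \<open>{..c}\<close> have codes below
  \<open>2 ^ Suc c\<close>, so a family of them is a set of such numbers and has a code below two to
  that power.\<close>

lemma nodes_surj:
  assumes "W \<subseteq> Pow {..c}"
  shows "\<exists>w < 2 ^ (2 ^ Suc c). nodes c w = W"
proof -
  have fin: "finite D" if "D \<in> W" for D using assms that finite_subset by blast
  have "finite W" using assms by (meson finite_Pow_iff finite_atMost finite_subset)
  have lt: "set_encode D < 2 ^ Suc c" if "D \<in> W" for D
    using subsetD[OF assms that] by (intro set_encode_less) (auto simp: less_Suc_eq_le)
  define w where "w = set_encode (set_encode ` W)"
  have "set_decode w = set_encode ` W" using \<open>finite W\<close> by (simp add: w_def set_encode_inverse)
  then have "{d. d < 2 ^ Suc c \<and> d \<in> set_decode w} = set_encode ` W" using lt by auto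
  then have "nodes c w = W" using fin by (simp add: nodes_def image_image set_encode_inverse)
  moreover have "w < 2 ^ (2 ^ Suc c)" unfolding w_def using lt by (intro set_encode_less) auto
  ultimately show ?thesis by blast
qed

lemma set_decode_eq_iff: "set_decode d = set_decode e \<longleftrightarrow> d = e"
  by (metis set_decode_inverse)

text \<open>Inclusion is spelled out with a bounded quantifier to keep the predicate recursive;
  testing up to c is enough for codes below \<open>2 ^ Suc c\<close>.\<close>

definition maximal_code :: "nat \<Rightarrow> nat \<Rightarrow> nat \<Rightarrow> bool" where
  "maximal_code c w d \<longleftrightarrow> d \<in> set_decode w \<and>
     (\<forall>e < 2 ^ Suc c. e \<in> set_decode w \<longrightarrow>
       (\<forall>z < Suc c. z \<in> set_decode d \<longrightarrow> z \<in> set_decode e) \<longrightarrow> e = d)"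

text \<open>Brings the condition into a form built from bounded quantifiers and a bounded sum, to
  which \<open>rec_intros\<close> applies.\<close>

lemma countermodel_nodes_iff:
  "countermodel n c (nodes c w) \<longleftrightarrow>
     (\<exists>d < 2 ^ Suc c. d \<in> set_decode w \<and> c \<notin> set_decode d \<and>
       (\<forall>e < 2 ^ Suc c. e \<in> set_decode w \<longrightarrow> (\<forall>z < Suc c. z \<in> set_decode d \<longrightarrow> z \<in> set_decode e))) \<and>
     (\<Sum>d < 2 ^ Suc c. of_bool (maximal_code c w d)) \<le> n \<and>
     (\<forall>d < 2 ^ Suc c. d \<in> set_decode w \<longrightarrow> 0 \<notin> set_decode d \<and> (\<forall>x<c. \<forall>y<c.
        (Suc (4 * prod_encode (x, y) + 1) \<le> c \<longrightarrow>
          (Suc (4 * prod_encode (x, y) + 1) \<in> set_decode d \<longleftrightarrow> x \<in> set_decode d \<and> y \<in> set_decode d)) \<and>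
        (Suc (4 * prod_encode (x, y) + 2) \<le> c \<longrightarrow>
          (Suc (4 * prod_encode (x, y) + 2) \<in> set_decode d \<longleftrightarrow> x \<in> set_decode d \<or> y \<in> set_decode d)) \<and>
        (Suc (4 * prod_encode (x, y) + 3) \<le> c \<longrightarrow>
          (Suc (4 * prod_encode (x, y) + 3) \<in> set_decode d \<longleftrightarrow>
            (\<forall>e < 2 ^ Suc c. e \<in> set_decode w \<longrightarrow>
              (\<forall>z < Suc c. z \<in> set_decode d \<longrightarrow> z \<in> set_decode e) \<longrightarrow>
              x \<in> set_decode e \<longrightarrow> y \<in> set_decode e)))))"
proof -
  define N where "N = {d. d < 2 ^ Suc c \<and> d \<in> set_decode w}"
  have nodes: "nodes c w = set_decode ` N" by (simp add: nodes_def N_def)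
  have sub: "set_decode d \<subseteq> set_decode e \<longleftrightarrow> (\<forall>z < Suc c. z \<in> set_decode d \<longrightarrow> z \<in> set_decode e)"
    if "d \<in> N" for d e
  proof -
    have "set_decode d \<subseteq> {..c}" using nodes_subset[of c w] that unfolding nodes by blast
    then show ?thesis by (auto simp: less_Suc_eq_le)
  qed
  have ball: "(\<forall>d < 2 ^ Suc c. d \<in> set_decode w \<longrightarrow> P d) \<longleftrightarrow> (\<forall>d\<in>N. P d)" for P
    by (auto simp: N_def)
  have bex: "(\<exists>d < 2 ^ Suc c. d \<in> set_decode w \<and> P d) \<longleftrightarrow> (\<exists>d\<in>N. P d)" for P
    by (auto simp: N_def)
  have "{D \<in> nodes c w. \<forall>E\<in>nodes c w. D \<subseteq> E \<longrightarrow> E = D} = set_decode ` {d \<in> N. maximal_code c w d}"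
    unfolding maximal_code_def ball unfolding nodes by (auto simp: sub set_decode_eq_iff N_def)
  moreover have "inj_on set_decode A" for A by (simp add: inj_on_def set_decode_eq_iff)
  ultimately have "card {D \<in> nodes c w. \<forall>E\<in>nodes c w. D \<subseteq> E \<longrightarrow> E = D} = card {d \<in> N. maximal_code c w d}"
    by (simp add: card_image)
  also have "{d \<in> N. maximal_code c w d} = {..<2 ^ Suc c} \<inter> {d. maximal_code c w d}"
    by (auto simp: N_def maximal_code_def)
  also have "card \<dots> = (\<Sum>d < 2 ^ Suc c. of_bool (maximal_code c w d))"
    by simp
  finally have card: "card {D \<in> nodes c w. \<forall>E\<in>nodes c w. D \<subseteq> E \<longrightarrow> E = D}
    = (\<Sum>d < 2 ^ Suc c. of_bool (maximal_code c w d))" .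
  show ?thesis
    unfolding countermodel_def card ball bex
    using nodes_subset[of c w] unfolding nodes by (simp add: sub)
qed

lemma recp_countermodel:
  "recp 1 (\<lambda>xs. \<exists>w < 2 ^ (2 ^ Suc (hd xs)). countermodel n (hd xs) (nodes (hd xs) w))"
  \<comment> \<open>The arity 1 has to read \<open>Suc 0\<close> to match the rules for
    \<open>hd\<close>.\<close>
  unfolding countermodel_nodes_iff maximal_code_def One_nat_def
  by (intro rec_intros)

theorem theorem2p5:
  fixes k n :: nat
  assumes "k \<ge> 1"
    and "n = (LEAST m. m \<ge> 1 \<and> m choose (m div 2) \<ge> k)"
  shows "(\<forall>a. a \<in> IPC_plus (phi k) \<longleftrightarrow>
           (\<forall>(K :: nat set) (R :: nat rel).
              kripke_frame K R \<and> finite K \<and> topwidth_at_most K R n \<longrightarrow> holds_in K R a))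
         \<and> decidable (IPC_plus (phi k))"
proof -
  \<comment> \<open>The middle coefficient is at least \<open>k choose 1\<close>, so k itself
    witnesses that the least number exists.\<close>
  have "k choose (k div 2) \<ge> k" using binomial_maximum[of k 1] by simp
  then have "n \<ge> 1 \<and> n choose (n div 2) \<ge> k" unfolding assms(2) using assms(1) by (intro LeastI) blast
  note n = assms(1) conjunct2[OF this] conjunct1[OF this]
  have sound: "holds_in K R a"
    if "kripke_frame K R" "topwidth_at_most K R n" "a \<in> IPC_plus (phi k)" for K :: "nat set" and R a
    using IPC_plus_phi_sound[OF assms that] .
  \<comment> \<open>The nodes of W are sets of numbers; \<open>finite_frames_nat\<close> moves the
    refutation to a frame on numbers.\<close>
  have refuted: "\<exists>(K :: nat set) R. kripke_frame K R \<and> finite K \<and> topwidth_at_most K R n \<and> \<not> holds_in K R a"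
    if "countermodel n (fm_code a) W" for W a
    using finite_frames_nat[of n a W] countermodel_refutes[OF that] by blast
  have complete: "a \<in> IPC_plus (phi k) \<longleftrightarrow>
      (\<forall>(K :: nat set) R. kripke_frame K R \<and> finite K \<and> topwidth_at_most K R n \<longrightarrow> holds_in K R a)" for a
    using sound refuted countermodel_if_not_derivable[OF n] by blast
  have code: "fm_code a \<notin> fm_code ` IPC_plus (phi k) \<longleftrightarrow>
      (\<exists>w < 2 ^ (2 ^ Suc (fm_code a)). countermodel n (fm_code a) (nodes (fm_code a) w))" for a
  proof -
    have "fm_code a \<notin> fm_code ` IPC_plus (phi k) \<longleftrightarrow> a \<notin> IPC_plus (phi k)"
      using bij_is_inj[OF bij_fm_code] by (simp add: inj_image_mem_iff)
    also have "\<dots> \<longleftrightarrow> (\<exists>W. countermodel n (fm_code a) W)"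
      using complete refuted countermodel_if_not_derivable[OF n] by blast
    also have "\<dots> \<longleftrightarrow> (\<exists>w < 2 ^ (2 ^ Suc (fm_code a)). countermodel n (fm_code a) (nodes (fm_code a) w))"
      using nodes_surj[OF countermodel_subset] by metis
    finally show ?thesis .
  qed
  have "c \<in> fm_code ` IPC_plus (phi k) \<longleftrightarrow>
      \<not> (\<exists>w < 2 ^ (2 ^ Suc c). countermodel n c (nodes c w))" for c
  proof -
    \<comment> \<open>The numbering is onto, so the equivalence for codes of formulas covers every
      number.\<close>
    obtain a where "c = fm_code a" using bij_is_surj[OF bij_fm_code] by (rule surjE)
    then show ?thesis using code by blast
  qed
  then have "decidable (IPC_plus (phi k))"
    unfolding decidable_def
    using recursive_set_if_recp[of "fm_code ` IPC_plus (phi k)"] recp_not[OF recp_countermodel[of n]]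
    by simp
  then show ?thesis using complete by blast
qed

end
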